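(* Let $A$ be an infinite dimensional simple unital C*-algebra, and let $B \subset A$ be a large subalgebra. Then $B$ is infinite dimensional.
   Context: Subalgebras are C*-subalgebras; a unital subalgebra of $A$ contains the identity of $A$. For a C*-algebra $D$ and $a, b \in D_{+}$ (positive elements), $a \precsim_D b$ (Cuntz subequivalence) means there is a sequence $(v_n)$ in $D$ with $\lim_{n \to \infty} v_n b v_n^* = a$. Large subalgebra: let $A$ be an infinite dimensional simple unital C*-algebra. A unital subalgebra $B \subset A$ is large in $A$ if for every integer $m \geq 1$, $a_1, \ldots, a_m \in A$, $\varepsilon > 0$, $x \in A_{+}$ with $\|x\| = 1$, and $y \in B_{+} \setminus \{0\}$, there are $c_1, \ldots, c_m \in A$ and $g \in B$ such that: (1) $0 \leq g \leq 1$; (2) $\|c_j - a_j\| < \varepsilon$ for $j = 1, \ldots, m$; (3) $(1-g) c_j \in B$ for $j = 1, \ldots, m$; (4) $g \precsim_B y$ and $g \precsim_A x$; (5) $\|(1-g) x (1-g)\| > 1 - \varepsilon$. *)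

theory Defs
  imports "HOL-Analysis.Analysis"
begin

text \<open>The library has no complex normed algebras, so complex scalars extend the real ones of
  \<^class>\<open>real_normed_algebra_1\<close>. That class demands \<open>0 \<noteq> 1\<close> and \<open>norm 1 = 1\<close>; the first excludes
  only the zero algebra and the second then follows from the C*-identity.\<close>

class unital_cstar_algebra = real_normed_algebra_1 + banach +
  fixes scaleC :: "complex \<Rightarrow> 'a \<Rightarrow> 'a" (infixr \<open>*\<^sub>C\<close> 75)
    and adj :: "'a \<Rightarrow> 'a"
  assumes scaleC_add_right: "z *\<^sub>C (a + b) = z *\<^sub>C a + z *\<^sub>C b"
    and scaleC_add_left: "(z + w) *\<^sub>C a = z *\<^sub>C a + w *\<^sub>C a"
    and scaleC_scaleC: "z *\<^sub>C w *\<^sub>C a = (z * w) *\<^sub>C a"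
    and scaleC_complex_of_real: "complex_of_real r *\<^sub>C a = r *\<^sub>R a"
    and mult_scaleC_left: "(z *\<^sub>C a) * b = z *\<^sub>C (a * b)"
    and mult_scaleC_right: "a * (z *\<^sub>C b) = z *\<^sub>C (a * b)"
    and norm_scaleC: "norm (z *\<^sub>C a) = cmod z * norm a"
    and adj_adj: "adj (adj a) = a"
    and adj_add: "adj (a + b) = adj a + adj b"
    and adj_scaleC: "adj (z *\<^sub>C a) = cnj z *\<^sub>C adj a"
    and adj_mult: "adj (a * b) = adj b * adj a"
    and cstar_identity: "norm (adj a * a) = (norm a)\<^sup>2"

lemma scaleC_one: "1 *\<^sub>C a = (a :: 'a :: unital_cstar_algebra)"
  using scaleC_complex_of_real[of 1 a] by simp

global_interpretation complex_vector: vector_space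
  "scaleC :: complex \<Rightarrow> 'a \<Rightarrow> 'a :: unital_cstar_algebra"
  by unfold_locales
    (simp_all add: scaleC_add_right scaleC_add_left scaleC_scaleC scaleC_one)

text \<open>Dimension is over the complex numbers. The predicate is meant for complex subspaces.\<close>

definition infinite_dimensional :: "'a :: unital_cstar_algebra set \<Rightarrow> bool" where
  "infinite_dimensional V \<longleftrightarrow>
     \<not> (\<exists>F. finite F \<and> F \<subseteq> V \<and> V \<subseteq> complex_vector.span F)"

definition closed_ideal :: "'a :: unital_cstar_algebra set \<Rightarrow> bool" where
  "closed_ideal I \<longleftrightarrow> complex_vector.subspace I \<and> closed I \<and>
     (\<forall>a. \<forall>x\<in>I. a * x \<in> I \<and> x * a \<in> I)"

definition simple_cstar_algebra :: "'a :: unital_cstar_algebra itself \<Rightarrow> bool" where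
  "simple_cstar_algebra _ \<longleftrightarrow> (\<forall>I :: 'a set. closed_ideal I \<longrightarrow> I = {0} \<or> I = UNIV)"

definition unital_cstar_subalgebra :: "'a :: unital_cstar_algebra set \<Rightarrow> bool" where
  "unital_cstar_subalgebra B \<longleftrightarrow> complex_vector.subspace B \<and> closed B \<and> 1 \<in> B \<and>
     (\<forall>a\<in>B. \<forall>b\<in>B. a * b \<in> B) \<and> (\<forall>a\<in>B. adj a \<in> B)"

text \<open>In what follows \<open>D\<close> stands for a unital C*-subalgebra, with \<^term>\<open>UNIV\<close> for the whole
  algebra. Spectrum and positivity are computed inside \<open>D\<close>.\<close>

definition spectrum :: "'a :: unital_cstar_algebra set \<Rightarrow> 'a \<Rightarrow> complex set" where
  "spectrum D a = {z. \<not> (\<exists>b\<in>D. b * (a - z *\<^sub>C 1) = 1 \<and> (a - z *\<^sub>C 1) * b = 1)}"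

definition positives :: "'a :: unital_cstar_algebra set \<Rightarrow> 'a set" where
  "positives D = {a \<in> D. adj a = a \<and> spectrum D a \<subseteq> complex_of_real ` {0..}}"

text \<open>Meant for \<open>a\<close> and \<open>b\<close> in \<^term>\<open>positives D\<close>.\<close>

definition cuntz_subequiv :: "'a :: unital_cstar_algebra set \<Rightarrow> 'a \<Rightarrow> 'a \<Rightarrow> bool" where
  "cuntz_subequiv D a b \<longleftrightarrow>
     (\<exists>v :: nat \<Rightarrow> 'a. (\<forall>n. v n \<in> D) \<and> (\<lambda>n. v n * b * adj (v n)) \<longlonglongrightarrow> a)"

text \<open>The order relation \<open>0 \<le> g \<le> 1\<close> says that \<open>g\<close> and \<open>1 - g\<close> are positive.\<close>

definition large_subalgebra :: "'a :: unital_cstar_algebra set \<Rightarrow> bool" where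
  "large_subalgebra B \<longleftrightarrow> unital_cstar_subalgebra B \<and>
     (\<forall>(m::nat) (a :: nat \<Rightarrow> 'a) (\<epsilon>::real) x y.
        m \<ge> 1 \<longrightarrow> \<epsilon> > 0 \<longrightarrow> x \<in> positives UNIV \<longrightarrow> norm x = 1 \<longrightarrow> y \<in> positives B - {0} \<longrightarrow>
        (\<exists>(c :: nat \<Rightarrow> 'a). \<exists>g\<in>B.
           g \<in> positives B \<and> 1 - g \<in> positives B \<and>
           (\<forall>j\<in>{1..m}. norm (c j - a j) < \<epsilon>) \<and>
           (\<forall>j\<in>{1..m}. (1 - g) * c j \<in> B) \<and>
           cuntz_subequiv B g y \<and> cuntz_subequiv UNIV g x \<and>
           norm ((1 - g) * x * (1 - g)) > 1 - \<epsilon>))"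

end

theory Submission imports Defs begin

text \<open>Suppose \<open>B\<close> is finite dimensional, so that its unit sphere is compact. Applying largeness with
  \<open>x = y = 1\<close> and normalising \<open>1 - g\<close> produces, for every finite \<open>S \<subseteq> A\<close> and \<open>\<epsilon> > 0\<close>, an element
  \<open>h\<close> of the unit sphere of \<open>B\<close> such that \<open>h a\<close> is within \<open>\<epsilon>\<close> of \<open>B\<close> for all \<open>a \<in> S\<close>. By
  compactness a single \<open>h\<close> serves all \<open>S\<close> and \<open>\<epsilon>\<close>, so \<open>h A \<subseteq> B\<close>. Hence the two-sided ideal of
  all \<open>x\<close> for which \<open>x A\<close> is finite dimensional is nonzero; by simplicity it is dense, so it
  contains some \<open>x\<close> with \<open>\<parallel>1 - x\<parallel> < 1\<close>. Such an \<open>x\<close> is invertible and \<open>A = x A\<close> is finite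
  dimensional.\<close>

section \<open>Finite-dimensional complex subspaces: compact balls and closedness\<close>

text \<open>Makes the continuity and limit rules for real bounded bilinear maps available for
  complex scaling.\<close>

lemma bounded_bilinear_scaleC:
  "bounded_bilinear (scaleC :: complex \<Rightarrow> 'a \<Rightarrow> 'a :: unital_cstar_algebra)"
proof
  fix z :: complex and a :: 'a and r :: real
  show "(r *\<^sub>R z) *\<^sub>C a = r *\<^sub>R (z *\<^sub>C a)"
    unfolding scaleR_conv_of_real[of r z] scaleC_scaleC[symmetric] scaleC_complex_of_real
    by (rule refl)
  show "z *\<^sub>C (r *\<^sub>R a) = r *\<^sub>R (z *\<^sub>C a)"
    unfolding scaleC_complex_of_real[symmetric] scaleC_scaleC by (simp only: mult.commute)
  show "\<exists>K. \<forall>z a. norm (z *\<^sub>C (a :: 'a)) \<le> norm z * norm a * K"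
    by (intro exI[of _ 1]) (simp add: norm_scaleC)
qed (simp_all add: scaleC_add_right scaleC_add_left)

text \<open>Only points of \<open>S\<close> with norm at most \<open>norm v + 1\<close> can lie
  within 1 of \<open>v\<close>, so one bounded part decides. Bounded parts are what the compactness
  induction below supplies.\<close>

lemma separated_if_bounded_parts_closed:
  fixes S :: "'a :: real_normed_vector set"
  assumes "\<And>r. closed (S \<inter> cball 0 r)" and "v \<notin> S"
  obtains d where "d > 0" and "\<And>s. s \<in> S \<Longrightarrow> d \<le> norm (v - s)"
proof -
  have "open (- (S \<inter> cball 0 (norm v + 1)))"
    using assms(1) by blast
  then obtain e where e: "e > 0" "ball v e \<subseteq> - (S \<inter> cball 0 (norm v + 1))"
    using assms(2) by (meson ComplI IntD1 open_contains_ball)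
  show thesis
  proof (rule that[of "min e 1"])
    fix s assume "s \<in> S"
    show "min e 1 \<le> norm (v - s)"
    proof (rule ccontr)
      assume "\<not> ?thesis"
      then have "norm (v - s) < e" "norm (v - s) < 1" by auto
      moreover have "norm s \<le> norm v + norm (v - s)"
        using norm_triangle_ineq4[of v "v - s"] by simp
      ultimately show False
        using e(2) \<open>s \<in> S\<close> by (auto simp: dist_norm subset_iff)
    qed
  qed (use e in simp)
qed

text \<open>Induction on \<open>F\<close>. A new vector \<open>v\<close> outside the old span keeps
  a distance \<open>d > 0\<close> from it, which bounds both the coefficient of \<open>v\<close> and
  the remainder. The ball part is then a closed piece of a continuous image of a compact
  product.\<close>

lemma compact_span_Int_cball:
  fixes F :: "'a :: unital_cstar_algebra set"
  assumes "finite F"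
  shows "compact (complex_vector.span F \<inter> cball 0 r)"
  using assms
proof (induction F arbitrary: r rule: finite_induct)
  case empty
  then show ?case by (simp add: compact_Int_closed)
next
  case (insert v F)
  show ?case
  proof (cases "v \<in> complex_vector.span F")
    case True
    then show ?thesis using insert.IH by (simp add: complex_vector.span_redundant)
  next
    case False
    obtain d where d: "d > 0" "\<And>s. s \<in> complex_vector.span F \<Longrightarrow> d \<le> norm (v - s)"
      using separated_if_bounded_parts_closed[OF compact_imp_closed[OF insert.IH] False] by blast
    \<comment> \<open>For \<open>x = z *\<^sub>C v + s\<close> of norm at most \<open>r\<close>, the
      distance \<open>d\<close> forces \<open>cmod z \<le> r / d\<close>; the triangle inequality
      then gives the radius for \<open>s\<close>.\<close>
    define T where "T = (cball 0 (r / d) :: complex set) \<times>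
      (complex_vector.span F \<inter> cball 0 (r + r / d * norm v))"
    define K where "K = (\<lambda>(z, s). z *\<^sub>C v + s) ` T"
    have "compact T"
      unfolding T_def by (rule compact_Times[OF compact_cball insert.IH])
    moreover have "continuous_on T (\<lambda>p. fst p *\<^sub>C v + snd p)"
      by (rule continuous_on_add[OF bounded_bilinear.continuous_on[OF bounded_bilinear_scaleC
            continuous_on_fst[OF continuous_on_id] continuous_on_const]
          continuous_on_snd[OF continuous_on_id]])
    ultimately have "compact K"
      unfolding K_def case_prod_unfold by (rule compact_continuous_image[rotated])
    moreover have "complex_vector.span (insert v F) \<inter> cball 0 r = K \<inter> cball 0 r"
    proof (intro set_eqI iffI)
      fix x assume x: "x \<in> K \<inter> cball 0 r"
      then obtain z s where "x = z *\<^sub>C v + s" "s \<in> complex_vector.span F"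
        by (auto simp: K_def T_def)
      then have "x - z *\<^sub>C v \<in> complex_vector.span F" by simp
      with x show "x \<in> complex_vector.span (insert v F) \<inter> cball 0 r"
        by (auto simp only: complex_vector.span_breakdown_eq)
    next
      fix x assume x: "x \<in> complex_vector.span (insert v F) \<inter> cball 0 r"
      then obtain z where z: "x - z *\<^sub>C v \<in> complex_vector.span F"
        by (auto simp: complex_vector.span_breakdown_eq)
      have "cmod z * d \<le> norm x"
      proof (cases "z = 0")
        case False
        \<comment> \<open>Factoring out \<open>z\<close> writes \<open>x\<close> as \<open>z\<close>
          times the difference of \<open>v\<close> and an element of the old span, and that
          difference has norm at least \<open>d\<close>.\<close>
        have eq: "z *\<^sub>C (v - (- inverse z) *\<^sub>C (x - z *\<^sub>C v)) = x"
          using False by (simp add: scaleC_add_right scaleC_scaleC scaleC_one)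
        have "d \<le> norm (v - (- inverse z) *\<^sub>C (x - z *\<^sub>C v))"
          by (intro d complex_vector.span_scale z)
        then have "cmod z * d \<le> norm (z *\<^sub>C (v - (- inverse z) *\<^sub>C (x - z *\<^sub>C v)))"
          unfolding norm_scaleC by (rule mult_left_mono) simp
        then show ?thesis
          unfolding eq .
      qed simp
      then have zr: "cmod z \<le> r / d"
        using x d(1) by (simp add: field_simps)
      have "norm (x - z *\<^sub>C v) \<le> norm x + cmod z * norm v"
        using norm_triangle_ineq4[of x "z *\<^sub>C v"] by (simp add: norm_scaleC)
      also have "\<dots> \<le> r + r / d * norm v"
        using x zr by (intro add_mono mult_right_mono) auto
      finally have "(z, x - z *\<^sub>C v) \<in> T"
        using z zr by (simp add: T_def)
      then have "x \<in> K"
        unfolding K_def by (rule rev_image_eqI) simp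
      with x show "x \<in> K \<inter> cball 0 r" by simp
    qed
    ultimately show ?thesis
      by (simp add: compact_Int_closed)
  qed
qed

lemma closed_span_finite:
  fixes F :: "'a :: unital_cstar_algebra set"
  assumes "finite F"
  shows "closed (complex_vector.span F)"
proof -
  have "\<exists>d>0. ball v d \<subseteq> - complex_vector.span F" if "v \<notin> complex_vector.span F" for v
    using separated_if_bounded_parts_closed
      [OF compact_imp_closed[OF compact_span_Int_cball[OF assms]] that]
    by (metis ComplI dist_norm mem_ball not_le subsetI)
  then show ?thesis
    by (simp add: closed_open open_contains_ball)
qed

section \<open>Positivity of the unit and closures of ideals\<close>

lemma adj_one: "adj 1 = (1 :: 'a :: unital_cstar_algebra)"
  by (metis adj_adj adj_mult mult.right_neutral)

text \<open>Admits the unit as test element in largeness, both as \<open>x\<close> in the whole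
  algebra and as \<open>y\<close> in \<open>B\<close>.\<close>

lemma one_in_positives:
  fixes D :: "'a :: unital_cstar_algebra set"
  assumes "complex_vector.subspace D" "1 \<in> D"
  shows "1 \<in> positives D"
proof -
  have "z = 1" if "z \<in> spectrum D 1" for z
  proof (rule ccontr)
    assume "z \<noteq> 1"
    have "(1 :: 'a) - z *\<^sub>C 1 = (1 - z) *\<^sub>C 1"
      by (simp add: complex_vector.scale_left_diff_distrib scaleC_one)
    then have "(inverse (1 - z) *\<^sub>C 1) * ((1 :: 'a) - z *\<^sub>C 1) = 1 \<and>
        ((1 :: 'a) - z *\<^sub>C 1) * (inverse (1 - z) *\<^sub>C 1) = 1"
      using \<open>z \<noteq> 1\<close> by (simp add: mult_scaleC_left mult_scaleC_right scaleC_scaleC scaleC_one)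
    moreover have "inverse (1 - z) *\<^sub>C (1 :: 'a) \<in> D"
      using assms by (simp add: complex_vector.subspace_scale)
    ultimately show False
      using that unfolding spectrum_def by blast
  qed
  then have "spectrum D 1 \<subseteq> complex_of_real ` {0..}"
    by (auto intro!: image_eqI[of _ _ 1])
  then show ?thesis
    using assms by (simp add: positives_def adj_one)
qed

text \<open>Simplicity speaks of norm-closed ideals only, so an algebraic two-sided ideal is closed
  up before simplicity applies to it.\<close>

lemma closed_ideal_closure:
  fixes I :: "'a :: unital_cstar_algebra set"
  assumes I: "complex_vector.subspace I" and mult: "\<And>a x. x \<in> I \<Longrightarrow> a * x \<in> I \<and> x * a \<in> I"
  shows "closed_ideal (closure I)"
proof -
  have scale: "z *\<^sub>C x \<in> closure I" and left: "a * x \<in> closure I" and right: "x * a \<in> closure I"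
    if "x \<in> closure I" for z a x
  proof -
    obtain f where f: "\<And>n. f n \<in> I" "f \<longlonglongrightarrow> x"
      using \<open>x \<in> closure I\<close> unfolding closure_sequential by blast
    show "z *\<^sub>C x \<in> closure I"
      unfolding closure_sequential
      using f bounded_bilinear.tendsto[OF bounded_bilinear_scaleC tendsto_const f(2)]
      by (intro exI[of _ "\<lambda>n. z *\<^sub>C f n"]) (auto intro: complex_vector.subspace_scale[OF I])
    show "a * x \<in> closure I"
      unfolding closure_sequential
      using f mult by (intro exI[of _ "\<lambda>n. a * f n"]) (auto intro: tendsto_intros)
    show "x * a \<in> closure I"
      unfolding closure_sequential
      using f mult by (intro exI[of _ "\<lambda>n. f n * a"]) (auto intro: tendsto_intros)
  qed
  have "x + y \<in> closure I" if xy: "x \<in> closure I" "y \<in> closure I" for x y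
  proof -
    obtain f g where "\<And>n. f n \<in> I" "f \<longlonglongrightarrow> x" "\<And>n. g n \<in> I" "g \<longlonglongrightarrow> y"
      using xy unfolding closure_sequential by blast
    then show ?thesis
      unfolding closure_sequential
      by (intro exI[of _ "\<lambda>n. f n + g n"])
        (auto intro: tendsto_intros complex_vector.subspace_add[OF I])
  qed
  moreover have "0 \<in> closure I"
    using complex_vector.subspace_0[OF I] closure_subset by blast
  ultimately show ?thesis
    unfolding closed_ideal_def complex_vector.subspace_def
    using scale left right by simp
qed

section \<open>The ideal of elements \<open>x\<close> with \<open>x A\<close> finite
  dimensional\<close>

text \<open>The finite set may lie outside \<open>x A\<close>, so sums are handled by a union of
  spanning sets and left multiples by an image.\<close>

definition finite_range_ideal :: "'a :: unital_cstar_algebra set" where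
  "finite_range_ideal = {x. \<exists>F. finite F \<and> range ((*) x) \<subseteq> complex_vector.span F}"

lemma finite_range_idealI:
  "finite F \<Longrightarrow> (\<And>a. x * a \<in> complex_vector.span F) \<Longrightarrow> x \<in> finite_range_ideal"
  unfolding finite_range_ideal_def by blast

lemma finite_range_idealE:
  assumes "x \<in> finite_range_ideal"
  obtains F where "finite F" "\<And>a. x * a \<in> complex_vector.span F"
  using assms unfolding finite_range_ideal_def by blast

lemma mult_left_in_span_image:
  fixes a :: "'a :: unital_cstar_algebra"
  assumes "s \<in> complex_vector.span F"
  shows "a * s \<in> complex_vector.span ((*) a ` F)"
  using assms
proof (induction rule: complex_vector.span_induct_alt)
  case base
  then show ?case by (simp add: complex_vector.span_zero)
next
  case (step z x y)
  then show ?case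
    by (simp add: distrib_left mult_scaleC_right complex_vector.span_add
        complex_vector.span_scale complex_vector.span_base)
qed

lemma subspace_finite_range_ideal: "complex_vector.subspace finite_range_ideal"
proof (rule complex_vector.subspaceI)
  show "0 \<in> finite_range_ideal"
    by (rule finite_range_idealI[of "{}"]) auto
next
  fix x y :: 'a assume "x \<in> finite_range_ideal" "y \<in> finite_range_ideal"
  then obtain F G where "finite F" "\<And>a. x * a \<in> complex_vector.span F"
    and "finite G" "\<And>a. y * a \<in> complex_vector.span G"
    by (meson finite_range_idealE)
  then have "(x + y) * a \<in> complex_vector.span (F \<union> G)" for a
    unfolding distrib_right complex_vector.span_Un by blast
  then show "x + y \<in> finite_range_ideal"
    using \<open>finite F\<close> \<open>finite G\<close> by (intro finite_range_idealI[of "F \<union> G"]) auto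
next
  fix x :: 'a and z assume "x \<in> finite_range_ideal"
  then show "z *\<^sub>C x \<in> finite_range_ideal"
    by (metis finite_range_idealE finite_range_idealI mult_scaleC_left complex_vector.span_scale)
qed

text \<open>On the left, \<open>a x A\<close> lies in \<open>a\<close> times a finite span, again a
  finite span; on the right, \<open>x a A\<close> is contained in \<open>x A\<close>.\<close>

lemma mult_in_finite_range_ideal:
  assumes "x \<in> finite_range_ideal"
  shows "a * x \<in> finite_range_ideal" "x * a \<in> finite_range_ideal"
proof -
  obtain F where F: "finite F" "\<And>b. x * b \<in> complex_vector.span F"
    using assms by (rule finite_range_idealE) blast
  show "a * x \<in> finite_range_ideal"
    using F mult_left_in_span_image[OF F(2)]
    by (intro finite_range_idealI[of "(*) a ` F"]) (auto simp: mult.assoc)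
  show "x * a \<in> finite_range_ideal"
    using F by (intro finite_range_idealI[of F]) (auto simp: mult.assoc)
qed

text \<open>\<open>x\<close> times the partial sums of the Neumann series for \<open>x\<^sup>-\<^sup>1 a\<close> approximates \<open>a\<close> inside \<open>x A\<close>, which is
  enough because finite-dimensional subspaces are closed.\<close>

lemma finite_dimensional_if_finite_range_near_one:
  fixes x :: "'a :: unital_cstar_algebra"
  assumes "x \<in> finite_range_ideal" "norm (1 - x) < 1"
  shows "\<not> infinite_dimensional (UNIV :: 'a set)"
proof -
  obtain F where F: "finite F" "\<And>b. x * b \<in> complex_vector.span F"
    using assms(1) by (rule finite_range_idealE) blast
  define u where "u = 1 - x"
  have "(\<lambda>n. norm u ^ n) \<longlonglongrightarrow> 0"
    using assms(2) by (simp add: u_def LIMSEQ_power_zero)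
  then have "(\<lambda>n. u ^ n) \<longlonglongrightarrow> 0"
    by (rule Lim_null_comparison[rotated]) (simp add: norm_power_ineq)
  have "a \<in> complex_vector.span F" for a
  proof (rule closed_sequentially[OF closed_span_finite[OF F(1)]])
    have "(\<lambda>n. a - u ^ n * a) \<longlonglongrightarrow> a - 0 * a"
      by (intro tendsto_intros \<open>(\<lambda>n. u ^ n) \<longlonglongrightarrow> 0\<close>)
    then show "(\<lambda>n. a - u ^ n * a) \<longlonglongrightarrow> a" by simp
    show "a - u ^ n * a \<in> complex_vector.span F" for n
    proof (induction n)
      case 0
      then show ?case by (simp add: complex_vector.span_zero)
    next
      case (Suc n)
      have "a - u ^ Suc n * a = (a - u ^ n * a) + x * (u ^ n * a)"
        by (simp add: u_def left_diff_distrib mult.assoc)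
      then show ?case
        using Suc F(2) by (simp only: complex_vector.span_add)
    qed
  qed
  then show ?thesis
    using F(1) unfolding infinite_dimensional_def by blast
qed

lemma simple_finite_range_imp_finite_dimensional:
  fixes h :: "'a :: unital_cstar_algebra"
  assumes "simple_cstar_algebra TYPE('a)" "h \<in> finite_range_ideal" "h \<noteq> 0"
  shows "\<not> infinite_dimensional (UNIV :: 'a set)"
proof -
  have "closed_ideal (closure (finite_range_ideal :: 'a set))"
    by (intro closed_ideal_closure subspace_finite_range_ideal)
      (simp add: mult_in_finite_range_ideal)
  moreover have "h \<in> closure finite_range_ideal"
    using assms(2) closure_subset by blast
  ultimately have "1 \<in> closure (finite_range_ideal :: 'a set)"
    using assms(1,3) unfolding simple_cstar_algebra_def by blast
  then obtain x :: 'a where "x \<in> finite_range_ideal" "norm (1 - x) < 1"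
    by (metis closure_approachable dist_norm norm_minus_commute zero_less_one)
  then show ?thesis
    by (rule finite_dimensional_if_finite_range_near_one)
qed

section \<open>From largeness to a multiplier of \<open>A\<close> into \<open>B\<close>\<close>

text \<open>However small \<open>1 - g\<close> is, normalising it is harmless:
  \<open>h * c j\<close> stays in \<open>B\<close>, and since \<open>norm h = 1\<close>, replacing
  \<open>c j\<close> by \<open>a\<close> costs at most \<open>norm (c j - a)\<close>.\<close>

lemma large_subalgebra_near_multiplier:
  fixes B :: "'a :: unital_cstar_algebra set"
  assumes "large_subalgebra B" "finite S" "\<epsilon> > 0"
  obtains h where "h \<in> B" "norm h = 1" "\<And>a. a \<in> S \<Longrightarrow> infdist (h * a) B \<le> \<epsilon>"
proof -
  have B: "complex_vector.subspace B" "1 \<in> B"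
    using assms(1) by (auto simp: large_subalgebra_def unital_cstar_subalgebra_def)
  \<comment> \<open>Largeness asks for \<open>m \<ge> 1\<close>; the added 0 covers empty
    \<open>S\<close>.\<close>
  define T where "T = insert 0 S"
  obtain e where e: "bij_betw e {1..card T} T"
    using ex_bij_betw_nat_finite_1[of T] \<open>finite S\<close> T_def by auto
  have "card T \<ge> 1"
    using \<open>finite S\<close> by (simp add: T_def Suc_leI card_gt_0_iff)
  moreover have "1 \<in> positives (UNIV :: 'a set)" "1 \<in> positives B - {0}"
    using B by (auto intro: one_in_positives)
  \<comment> \<open>The tolerance is capped at 1 so that the lower bound in \<open>nz\<close> is
    nonnegative and hence \<open>1 - g \<noteq> 0\<close>.\<close>
  ultimately obtain c g where g: "g \<in> B"
    and c: "\<forall>j\<in>{1..card T}. norm (c j - e j) < min \<epsilon> 1"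
      "\<forall>j\<in>{1..card T}. (1 - g) * c j \<in> B"
    and nz: "norm ((1 - g) * 1 * (1 - g)) > 1 - min \<epsilon> 1"
    using assms(1,3) unfolding large_subalgebra_def
    by (metis min_less_iff_conj norm_one zero_less_one)
  define h where "h = (1 / norm (1 - g)) *\<^sub>R (1 - g)"
  have "1 - g \<noteq> 0" using nz by auto
  have scaleR: "r *\<^sub>R b \<in> B" if "b \<in> B" for r b
    using complex_vector.subspace_scale[OF B(1) that] scaleC_complex_of_real by metis
  show thesis
  proof (rule that)
    show "h \<in> B"
      unfolding h_def using B g by (intro scaleR complex_vector.subspace_diff)
    show h1: "norm h = 1"
      using \<open>1 - g \<noteq> 0\<close> by (simp add: h_def)
    fix a assume "a \<in> S"
    then obtain j where j: "j \<in> {1..card T}" "a = e j"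
      using e unfolding T_def bij_betw_def by blast
    have "h * c j \<in> B"
      using c(2) j scaleR by (simp add: h_def)
    then have "infdist (h * a) B \<le> dist (h * a) (h * c j)"
      by (rule infdist_le)
    also have "\<dots> = norm (h * (c j - a))"
      by (simp add: dist_norm norm_minus_commute right_diff_distrib)
    also have "\<dots> \<le> norm (c j - a)"
      using norm_mult_ineq[of h "c j - a"] h1 by simp
    also have "\<dots> \<le> \<epsilon>"
      using c(1) j by (simp add: less_imp_le)
    finally show "infdist (h * a) B \<le> \<epsilon>" .
  qed
qed

lemma finite_dimensional_large_subalgebra_multiplier:
  fixes B :: "'a :: unital_cstar_algebra set"
  assumes "large_subalgebra B" "finite F" "B = complex_vector.span F"
  obtains h where "h \<noteq> 0" "\<And>a. h * a \<in> B"
proof -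
  \<comment> \<open>Each pair of an element and a tolerance imposes a closed condition on
    \<open>h\<close>; the finite intersection property will meet all of them at once.\<close>
  define Q where "Q = (\<lambda>(a :: 'a, \<epsilon> :: real). {h. infdist (h * a) B \<le> \<epsilon>})"
  have "closed (sphere (0 :: 'a) 1)"
    unfolding sphere_def by (intro closed_Collect_eq continuous_intros)
  then have "compact (B \<inter> cball 0 1 \<inter> sphere 0 1)"
    unfolding assms(3) by (rule compact_Int_closed[OF compact_span_Int_cball[OF assms(2)]])
  then have "compact (B \<inter> sphere 0 1)"
    by (simp add: Int_absorb1 Int_assoc)
  moreover have "closed (Q p)" if "p \<in> UNIV \<times> {0<..}" for p
    unfolding Q_def case_prod_unfold by (intro closed_Collect_le continuous_intros)
  moreover have "(B \<inter> sphere 0 1) \<inter> (\<Inter>p\<in>I. Q p) \<noteq> {}"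
    if I: "finite I" "I \<subseteq> UNIV \<times> {0<..}" for I
  proof -
    \<comment> \<open>The smallest tolerance in \<open>I\<close> serves every pair; the inserted 1
      keeps \<open>Min\<close> meaningful for empty \<open>I\<close>.\<close>
    define \<epsilon> where "\<epsilon> = Min (insert 1 (snd ` I))"
    have "\<epsilon> > 0"
      using I by (subst \<epsilon>_def, subst Min_gr_iff) auto
    have \<epsilon>: "\<epsilon> \<le> snd p" if "p \<in> I" for p
      using I(1) that by (simp add: \<epsilon>_def)
    obtain h where "h \<in> B" "norm h = 1" "\<And>a. a \<in> fst ` I \<Longrightarrow> infdist (h * a) B \<le> \<epsilon>"
      using large_subalgebra_near_multiplier[OF assms(1) finite_imageI[OF I(1)] \<open>\<epsilon> > 0\<close>] by metis
    then have "h \<in> (B \<inter> sphere 0 1) \<inter> (\<Inter>p\<in>I. Q p)"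
      using \<epsilon> by (fastforce simp: Q_def case_prod_unfold)
    then show ?thesis by blast
  qed
  ultimately have "(B \<inter> sphere 0 1) \<inter> (\<Inter>p\<in>UNIV \<times> {0<..}. Q p) \<noteq> {}"
    by (rule compact_imp_fip_image)
  then obtain h where h: "h \<in> B" "norm h = 1"
    and Q: "\<forall>a. \<forall>\<epsilon>\<in>{0<..}. infdist (h * a) B \<le> \<epsilon>"
    by (auto simp: Q_def)
  show thesis
  proof (rule that)
    show "h \<noteq> 0" using h by auto
    fix a
    have "infdist (h * a) B \<le> 0"
      by (rule field_le_epsilon) (use Q in simp)
    then have "infdist (h * a) B = 0"
      by (simp add: antisym infdist_nonneg)
    \<comment> \<open>As \<open>infdist\<close> to the empty set is 0 by convention,
      \<open>h \<in> B\<close> is cited to make \<open>B\<close> nonempty.\<close>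
    then show "h * a \<in> B"
      using in_closed_iff_infdist_zero[of B "h * a"] closed_span_finite[OF assms(2)] assms(3) h(1)
      by auto
  qed
qed

theorem proposition5p5:
  fixes B :: "'a :: unital_cstar_algebra set"
  assumes "infinite_dimensional (UNIV :: 'a set)"
    and "simple_cstar_algebra TYPE('a)"
    and "large_subalgebra B"
  shows "infinite_dimensional B"
proof (rule ccontr)
  assume "\<not> infinite_dimensional B"
  then obtain F where F: "finite F" "F \<subseteq> B" "B \<subseteq> complex_vector.span F"
    unfolding infinite_dimensional_def by blast
  have "complex_vector.subspace B"
    using assms(3) by (simp add: large_subalgebra_def unital_cstar_subalgebra_def)
  then have span: "B = complex_vector.span F"
    using F complex_vector.span_minimal by blast
  obtain h where "h \<noteq> 0" "\<And>a. h * a \<in> B"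
    using finite_dimensional_large_subalgebra_multiplier[OF assms(3) F(1) span] by blast
  \<comment> \<open>All \<open>h * a\<close> lie in the span of \<open>F\<close>, so
    \<open>h\<close> is a nonzero member of the finite-range ideal.\<close>
  then show False
    using simple_finite_range_imp_finite_dimensional[OF assms(2) finite_range_idealI] F(1) span
      assms(1) by blast
qed

end
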